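(* Let $0<\beta\le1$ and $d\in\mathbb N$. The map $$\mathcal S_d(\mathbb R)_{\mathbb C}\ni\varphi\mapsto l_{\mu_\beta^{\otimes d}}(\varphi):=\int_{\mathcal S_d'(\mathbb R)}e^{\langle\omega,\varphi\rangle}\,d\mu_\beta^{\otimes d}(\omega)\in\mathbb C$$ is a holomorphic map from $\mathcal S_d(\mathbb R)_{\mathbb C}$ to $\mathbb C$.
   Context: For $0<\beta\le1$, $E_\beta(z)=\sum_{n=0}^\infty \frac{z^n}{\Gamma(\beta n+1)}$. $\mathcal S(\mathbb R)$ is the real Schwartz space, $\mathcal S'(\mathbb R)$ its dual with the cylinder $\sigma$-algebra, and $\mu_\beta$ is the unique probability measure on $\mathcal S'(\mathbb R)$ with $\int e^{i\langle\omega,\varphi\rangle}d\mu_\beta(\omega)=E_\beta(-\tfrac12\langle\varphi,\varphi\rangle)$ for $\varphi\in\mathcal S(\mathbb R)$, where $\langle\varphi,\varphi\rangle=\int\varphi^2dx$. $\mathcal S_d(\mathbb R)=\bigoplus_{k=1}^d\mathcal S(\mathbb R)$ is a nuclear Fréchet space with dual $\mathcal S_d'(\mathbb R)\cong\mathcal S'(\mathbb R)^d$, $\langle\omega,\varphi\rangle=\sum_{k=1}^d\langle\omega_k,\varphi_k\rangle$, and $\mu_\beta^{\otimes d}$ is the $d$-fold product measure on $\mathcal S_d'(\mathbb R)$. The subscript $\mathbb C$ denotes complexification; the dual pairing is extended bilinearly. A function on a complex locally convex space is holomorphic if it is locally bounded and G-holomorphic (its restriction $z\mapsto f(\varphi^0+z\varphi)$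 to each complex line is holomorphic near $0$ for all $\varphi^0,\varphi$). *)

theory Defs
  imports "HOL-Probability.Probability" "HOL-Complex_Analysis.Complex_Analysis"
begin

definition smooth_real :: "(real \<Rightarrow> real) \<Rightarrow> bool" where
  "smooth_real f \<longleftrightarrow> (\<forall>k x. (deriv ^^ k) f field_differentiable (at x))"

definition rapidly_decreasing :: "(real \<Rightarrow> real) \<Rightarrow> bool" where
  "rapidly_decreasing f \<longleftrightarrow> (\<forall>m k. bounded (range (\<lambda>x. x ^ m * (deriv ^^ k) f x)))"

lemma smooth_real_deriv_add:
  assumes "smooth_real f" "smooth_real g"
  shows "(deriv ^^ k) (\<lambda>x. f x + g x) = (\<lambda>x. (deriv ^^ k) f x + (deriv ^^ k) g x)"
proof (induction k)
  case (Suc k)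
  show ?case
    using assms unfolding smooth_real_def by (auto simp: Suc fun_eq_iff)
qed simp

lemma smooth_real_deriv_scale:
  assumes "smooth_real f"
  shows "(deriv ^^ k) (\<lambda>x. c * f x) = (\<lambda>x. c * (deriv ^^ k) f x)"
proof (induction k)
  case (Suc k)
  show ?case
    using assms unfolding smooth_real_def by (auto simp: Suc fun_eq_iff)
qed simp

lemma smooth_real_add:
  "smooth_real f \<Longrightarrow> smooth_real g \<Longrightarrow> smooth_real (\<lambda>x. f x + g x)"
  by (subst smooth_real_def) (auto simp: smooth_real_deriv_add smooth_real_def[of f]
      smooth_real_def[of g] intro!: field_differentiable_add)

lemma smooth_real_scale: "smooth_real f \<Longrightarrow> smooth_real (\<lambda>x. c * f x)"
  by (subst smooth_real_def) (auto simp: smooth_real_deriv_scale smooth_real_def[of f]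
      intro!: field_differentiable_mult)

lemma deriv_iterate_zero: "(deriv ^^ k) (\<lambda>x::real. 0::real) = (\<lambda>x. 0)"
  by (induction k) auto

lemma rapidly_decreasing_add:
  assumes "smooth_real f" "smooth_real g" "rapidly_decreasing f" "rapidly_decreasing g"
  shows "rapidly_decreasing (\<lambda>x. f x + g x)"
  unfolding rapidly_decreasing_def
proof (intro allI)
  fix m k
  have "bounded ((\<lambda>x. x ^ m * (deriv ^^ k) f x + x ^ m * (deriv ^^ k) g x) ` UNIV)"
    using assms(3,4) unfolding rapidly_decreasing_def by (intro bounded_plus_comp) auto
  then show "bounded (range (\<lambda>x. x ^ m * (deriv ^^ k) (\<lambda>x. f x + g x) x))"
    by (simp add: smooth_real_deriv_add assms distrib_left)
qed

lemma rapidly_decreasing_scale: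
  assumes "smooth_real f" "rapidly_decreasing f"
  shows "rapidly_decreasing (\<lambda>x. c * f x)"
  unfolding rapidly_decreasing_def
proof (intro allI)
  fix m k
  have "bounded ((\<lambda>x. c *\<^sub>R x) ` range (\<lambda>x. x ^ m * (deriv ^^ k) f x))"
    using assms(2) unfolding rapidly_decreasing_def by (intro bounded_scaling) auto
  then show "bounded (range (\<lambda>x. x ^ m * (deriv ^^ k) (\<lambda>x. c * f x) x))"
    by (simp add: smooth_real_deriv_scale assms image_image mult.left_commute)
qed

typedef schwartz = "{f. smooth_real f \<and> rapidly_decreasing f}"
  morphisms schwartz_fun Schwartz
  by (rule exI[of _ "\<lambda>x. 0"])
     (auto simp: smooth_real_def rapidly_decreasing_def deriv_iterate_zero)

setup_lifting type_definition_schwartz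

instantiation schwartz :: real_vector
begin

lift_definition zero_schwartz :: schwartz is "\<lambda>x. 0"
  by (auto simp: smooth_real_def rapidly_decreasing_def deriv_iterate_zero)

lift_definition plus_schwartz :: "schwartz \<Rightarrow> schwartz \<Rightarrow> schwartz" is "\<lambda>f g x. f x + g x"
  by (auto intro: smooth_real_add rapidly_decreasing_add)

lift_definition scaleR_schwartz :: "real \<Rightarrow> schwartz \<Rightarrow> schwartz" is "\<lambda>c f x. c * f x"
  by (auto intro: smooth_real_scale rapidly_decreasing_scale)

definition uminus_schwartz :: "schwartz \<Rightarrow> schwartz" where
  "uminus_schwartz f = (-1) *\<^sub>R f"

definition minus_schwartz :: "schwartz \<Rightarrow> schwartz \<Rightarrow> schwartz" where
  "minus_schwartz f g = f + (- g)"

instance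
  by standard
     (unfold minus_schwartz_def uminus_schwartz_def, (transfer, simp add: algebra_simps)+)

end

definition schwartz_seminorm :: "nat \<Rightarrow> nat \<Rightarrow> schwartz \<Rightarrow> real" where
  "schwartz_seminorm m k f = (SUP x. \<bar>x ^ m * (deriv ^^ k) (schwartz_fun f) x\<bar>)"

instantiation schwartz :: topological_space
begin

definition open_schwartz :: "schwartz set \<Rightarrow> bool" where
  "open_schwartz U \<longleftrightarrow> (\<forall>f\<in>U. \<exists>N. \<exists>\<epsilon>>0. \<forall>g.
     (\<forall>m\<le>N. \<forall>k\<le>N. schwartz_seminorm m k (g - f) < \<epsilon>) \<longrightarrow> g \<in> U)"

instance
proof
  show "open (UNIV :: schwartz set)"
    unfolding open_schwartz_def by (auto intro: exI[of _ 1])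
next
  fix S T :: "schwartz set"
  assume S: "open S" and T: "open T"
  show "open (S \<inter> T)"
    unfolding open_schwartz_def
  proof
    fix f assume f: "f \<in> S \<inter> T"
    from S f obtain N1 e1 where 1: "e1 > 0"
      "\<And>g. (\<forall>m\<le>N1. \<forall>k\<le>N1. schwartz_seminorm m k (g - f) < e1) \<Longrightarrow> g \<in> S"
      unfolding open_schwartz_def by blast
    from T f obtain N2 e2 where 2: "e2 > 0"
      "\<And>g. (\<forall>m\<le>N2. \<forall>k\<le>N2. schwartz_seminorm m k (g - f) < e2) \<Longrightarrow> g \<in> T"
      unfolding open_schwartz_def by blast
    show "\<exists>N. \<exists>\<epsilon>>0. \<forall>g. (\<forall>m\<le>N. \<forall>k\<le>N. schwartz_seminorm m k (g - f) < \<epsilon>) \<longrightarrow> g \<in> S \<inter> T"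
      by (rule exI[of _ "max N1 N2"], rule exI[of _ "min e1 e2"]) (use 1 2 in auto)
  qed
next
  fix K :: "schwartz set set"
  assume K: "\<forall>S\<in>K. open S"
  show "open (\<Union>K)"
    unfolding open_schwartz_def
  proof
    fix f assume "f \<in> \<Union>K"
    then obtain S where S: "S \<in> K" "f \<in> S" by blast
    with K obtain N e where "e > 0"
      "\<And>g. (\<forall>m\<le>N. \<forall>k\<le>N. schwartz_seminorm m k (g - f) < e) \<Longrightarrow> g \<in> S"
      unfolding open_schwartz_def by meson
    with S show "\<exists>N. \<exists>\<epsilon>>0. \<forall>g. (\<forall>m\<le>N. \<forall>k\<le>N. schwartz_seminorm m k (g - f) < \<epsilon>) \<longrightarrow> g \<in> \<Union>K"
      by blast
  qed
qed

end

definition tempered_distributions :: "(schwartz \<Rightarrow> real) set" where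
  "tempered_distributions = {\<omega>. linear \<omega> \<and> continuous_on UNIV \<omega>}"

definition cylinder_algebra :: "(schwartz \<Rightarrow> real) measure" where
  "cylinder_algebra = sigma tempered_distributions
     {{\<omega> \<in> tempered_distributions. \<omega> \<phi> \<in> B} | \<phi> B. B \<in> sets borel}"

definition mittag_leffler :: "real \<Rightarrow> complex \<Rightarrow> complex" where
  "mittag_leffler \<beta> z = (\<Sum>n. z ^ n / Gamma (complex_of_real (\<beta> * real n + 1)))"

text \<open>
  By Bochner-Minlos, for \<open>0 < \<beta> \<le> 1\<close> there is exactly one such measure. Existence is not
  constructed here, so the measure is characterised by a predicate.
\<close>

definition mittag_leffler_measure :: "real \<Rightarrow> (schwartz \<Rightarrow> real) measure \<Rightarrow> bool" where
  "mittag_leffler_measure \<beta> \<mu> \<longleftrightarrow>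
     prob_space \<mu> \<and> sets \<mu> = sets cylinder_algebra \<and>
     (\<forall>\<phi>. (\<integral>\<omega>. exp (\<i> * complex_of_real (\<omega> \<phi>)) \<partial>\<mu>) =
        mittag_leffler \<beta> (complex_of_real (- (1/2) * (\<integral>x. (schwartz_fun \<phi> x)\<^sup>2 \<partial>lborel))))"

text \<open>
  The complexification of a real vector space is the space of pairs \<open>(x, y)\<close>, read as
  \<open>x + iy\<close>, with the product topology.
\<close>

type_synonym 'a complexified = "'a \<times> 'a"

definition cscale :: "complex \<Rightarrow> 'a::real_vector complexified \<Rightarrow> 'a complexified" where
  "cscale z v = (Re z *\<^sub>R fst v - Im z *\<^sub>R snd v, Re z *\<^sub>R snd v + Im z *\<^sub>R fst v)"

definition locally_bounded :: "('a::topological_space \<Rightarrow> complex) \<Rightarrow> bool" where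
  "locally_bounded F \<longleftrightarrow> (\<forall>x. \<exists>U. open U \<and> x \<in> U \<and> bounded (F ` U))"

definition G_holomorphic :: "('a::real_vector complexified \<Rightarrow> complex) \<Rightarrow> bool" where
  "G_holomorphic F \<longleftrightarrow> (\<forall>\<phi>0 \<phi>. (\<lambda>z. F (\<phi>0 + cscale z \<phi>)) analytic_on {0})"

definition holomorphic_lcs ::
    "('a::{real_vector, topological_space} complexified \<Rightarrow> complex) \<Rightarrow> bool" where
  "holomorphic_lcs F \<longleftrightarrow> locally_bounded F \<and> G_holomorphic F"

text \<open>
  With \<open>d = CARD('d)\<close>, the type \<^typ>\<open>schwartz ^ 'd\<close> (with its product topology) is the
  \<open>d\<close>-fold direct sum of the Schwartz space, and its dual is represented by the families
  \<open>\<omega> :: 'd \<Rightarrow> schwartz \<Rightarrow> real\<close> of tempered distributions.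
\<close>

definition pairing :: "('d::finite \<Rightarrow> schwartz \<Rightarrow> real) \<Rightarrow> schwartz ^ 'd \<Rightarrow> real" where
  "pairing \<omega> \<phi> = (\<Sum>k\<in>UNIV. \<omega> k (\<phi> $ k))"

definition cpairing ::
    "('d::finite \<Rightarrow> schwartz \<Rightarrow> real) \<Rightarrow> (schwartz ^ 'd) complexified \<Rightarrow> complex" where
  "cpairing \<omega> \<phi> = complex_of_real (pairing \<omega> (fst \<phi>)) + \<i> * complex_of_real (pairing \<omega> (snd \<phi>))"

definition product_measure ::
    "(schwartz \<Rightarrow> real) measure \<Rightarrow> ('d::finite \<Rightarrow> schwartz \<Rightarrow> real) measure" where
  "product_measure \<mu> = PiM UNIV (\<lambda>_. \<mu>)"

definition laplace_transform ::
    "('d::finite \<Rightarrow> schwartz \<Rightarrow> real) measure \<Rightarrow> (schwartz ^ 'd) complexified \<Rightarrow> complex" where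
  "laplace_transform M \<phi> = (\<integral>\<omega>. exp (cpairing \<omega> \<phi>) \<partial>M)"

end

theory Submission
  imports Defs "HOL-Real_Asymp.Real_Asymp"
begin

text \<open>
  If \<open>X = \<langle>\<omega>, \<phi>\<rangle>\<close> has the characteristic function \<open>\<Sum>\<^sub>n a\<^sub>n (-t\<^sup>2)\<^sup>n\<close>
  with \<open>a\<^sub>n \<ge> 0\<close>, then \<open>E[((2 - 2 cos (t X)) / t\<^sup>2)\<^sup>n]\<close> is a normalised central difference of it, which
  tends to \<open>(2n)! a\<^sub>n\<close> as \<open>t \<rightarrow> 0\<close>. Fatou's lemma bounds the even moments by \<open>(2n)! a\<^sub>n\<close>, so
  \<open>E[cosh X] \<le> \<Sum>\<^sub>n a\<^sub>n\<close>. For the Mittag-Leffler measure this sum is \<open>E\<^sub>\<beta>(\<langle>\<phi>, \<phi>\<rangle> / 2)\<close>, and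
  \<open>\<langle>\<phi>, \<phi>\<rangle>\<close> is bounded near each point by two Schwartz seminorms; taking products over the
  coordinates gives integrability and local boundedness. On a complex line the integrand is
  expanded as a power series and integrated term by term, dominated by exponential moments.
\<close>

section \<open>Growth of the Gamma function and convergence of the Mittag-Leffler series\<close>

text \<open>Cut Euler's integral down to t >= R and replace t^x there by R^x. Since R is free, the
  bound makes Gamma outgrow every geometric sequence.\<close>

lemma Gamma_plus1_ge:
  fixes x R :: real
  assumes "0 \<le> x" "0 < R"
  shows "R powr x * exp (- R) \<le> Gamma (x + 1)"
proof (rule has_integral_le)
  have "((\<lambda>t. R powr x * exp (- 1 * t)) has_integral R powr x * (exp (- 1 * R) / 1)) {R..}"
    by (intro has_integral_mult_right has_integral_exp_minus_to_infinity) simp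
  then have "((\<lambda>t. R powr x * exp (- t)) has_integral R powr x * exp (- R)) {R..}"
    by simp
  then show "((\<lambda>t. if t \<in> {R..} then R powr x * exp (- t) else 0)
      has_integral R powr x * exp (- R)) {0..}"
    using assms by (subst has_integral_restrict) auto
  show "((\<lambda>t. t powr x / exp t) has_integral Gamma (x + 1)) {0..}"
    using Gamma_integral_real[of "x + 1"] assms by simp
  show "(if t \<in> {R..} then R powr x * exp (- t) else 0) \<le> t powr x / exp t"
    if "t \<in> {0..}" for t
    using assms that by (auto simp: exp_minus field_simps intro!: powr_mono2)
qed

lemma summable_power_over_Gamma:
  fixes \<beta> x :: real
  assumes "0 < \<beta>"
  shows "summable (\<lambda>n. x ^ n / Gamma (\<beta> * real n + 1))"
proof (rule summable_comparison_test')
  \<comment> \<open>R is chosen so that R^\<beta> = 2(|x| + 1): the lower bound for Gamma then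
    absorbs |x|^n and leaves a factor 2^(-n). The summand 1 keeps the base positive at x =
    0.\<close>
  define R where "R = (2 * (\<bar>x\<bar> + 1)) powr (1 / \<beta>)"
  have R: "R > 0" "R powr \<beta> = 2 * (\<bar>x\<bar> + 1)"
    using assms by (auto simp: R_def powr_powr)
  show "summable (\<lambda>n. exp R * (1 / 2) ^ n)"
    by (intro summable_mult summable_geometric) simp
  show "norm (x ^ n / Gamma (\<beta> * real n + 1)) \<le> exp R * (1 / 2) ^ n" for n
  proof -
    have g: "R powr (\<beta> * real n) * exp (- R) \<le> Gamma (\<beta> * real n + 1)"
      using assms R by (intro Gamma_plus1_ge) auto
    have p: "R powr (\<beta> * real n) = (2 * (\<bar>x\<bar> + 1)) ^ n"
      using R by (simp add: powr_powr[symmetric] powr_realpow)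
    have g0: "0 < Gamma (\<beta> * real n + 1)"
      using assms by (intro Gamma_real_pos) (simp add: add_nonneg_pos)
    have "\<bar>x\<bar> ^ n / Gamma (\<beta> * real n + 1) \<le> (\<bar>x\<bar> + 1) ^ n / ((2 * (\<bar>x\<bar> + 1)) ^ n * exp (- R))"
      using g g0 p by (intro frac_le power_mono) auto
    also have "\<dots> = exp R * (1 / 2) ^ n"
      using power_mult_distrib[of 2 "\<bar>x\<bar> + 1" n]
      by (simp add: exp_minus field_simps power_divide)
    finally show ?thesis
      using g0 by (simp add: norm_divide power_abs)
  qed
qed

section \<open>Central differences and even moments\<close>

text \<open>Up to the factor (2m)!, the sum is the coefficient of X^(2m) in (e^X - 1)^(2n) e^(-nX),
  expanded binomially. That series starts with X^(2n), so lower coefficients vanish and the leading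
  one is 1.\<close>

lemma central_difference_even_power:
  assumes "m \<le> n"
  shows "(\<Sum>k\<le>2 * n. real (2 * n choose k) * (- 1) ^ k * (real n - real k) ^ (2 * m)) =
    (if m = n then fact (2 * n) else 0)"
proof -
  \<comment> \<open>This is (e^X - 1)/X; its constant coefficient is 1, hence so is that of every
    power of it.\<close>
  define u :: "real fps" where "u = Abs_fps (\<lambda>j. 1 / fact (Suc j))"
  have X: "fps_exp 1 - 1 = fps_X * u"
    by (rule fps_ext) (auto simp: u_def fps_X_mult_nth gr0_conv_Suc)
  define c where "c k = real (2 * n choose k) * (- 1) ^ k" for k
  have "(fps_exp 1 - 1) ^ (2 * n) * fps_exp (- real n) =
      (\<Sum>k\<le>2 * n. fps_const (c k) * fps_exp (real n - real k))"
  proof -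
    have c: "of_nat (2 * n choose k) * (- 1) ^ k = fps_const (c k)" for k
    proof -
      have "(- 1 :: real fps) = fps_const (- 1)" by simp
      then show ?thesis
        by (simp only: c_def fps_of_nat[symmetric] fps_const_power fps_const_mult)
    qed
    have "(fps_exp 1 - 1 :: real fps) ^ (2 * n) =
        (\<Sum>k\<le>2 * n. fps_const (c k) * fps_exp 1 ^ (2 * n - k))"
      using binomial_ring[of "- 1" "fps_exp (1::real)" "2 * n"] by (simp add: c)
    moreover have "fps_exp (1::real) ^ (2 * n - k) * fps_exp (- real n) = fps_exp (real n - real k)"
      if "k \<le> 2 * n" for k
      using that by (simp add: fps_exp_power_mult fps_exp_add_mult[symmetric] of_nat_diff)
    ultimately show ?thesis
      by (auto simp: sum_distrib_right mult.assoc intro!: sum.cong)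
  qed
  then have "((fps_exp 1 - 1) ^ (2 * n) * fps_exp (- real n)) $ (2 * m) =
      (\<Sum>k\<le>2 * n. c k * (real n - real k) ^ (2 * m)) / fact (2 * m)"
    by (simp add: fps_sum_nth sum_divide_distrib)
  moreover have "((fps_exp 1 - 1) ^ (2 * n) * fps_exp (- real n)) $ (2 * m) =
      (if m = n then 1 else 0)"
    using assms by (simp add: X power_mult_distrib mult.assoc fps_X_power_mult_nth u_def fps_nth_power_0)
  ultimately show ?thesis
    by (auto simp: c_def field_simps split: if_splits)
qed

text \<open>With e = exp(iy) one has 2 - 2 cos y = -(e - 1)^2 / e; the binomial expansion of the
  n-th power gives the frequencies n - k. Taking expectations therefore yields a 2n-th central
  difference of the characteristic function.\<close>

lemma two_minus_two_cos_power:
  "complex_of_real ((2 - 2 * cos y) ^ n) =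
    (\<Sum>k\<le>2 * n. of_real ((- 1) ^ (n + k) * real (2 * n choose k)) *
      exp (\<i> * of_real ((real n - real k) * y)))"
proof -
  define e where "e = exp (\<i> * of_real y)"
  have e: "e \<noteq> 0" by (simp add: e_def)
  have "complex_of_real (2 - 2 * cos y) = - ((e - 1)\<^sup>2 / e)"
    using e by (simp add: e_def cos_exp_eq exp_minus flip: cos_of_real)
      (simp add: field_simps power2_eq_square)
  then have "complex_of_real ((2 - 2 * cos y) ^ n) = (- 1) ^ n * ((e - 1) ^ (2 * n) / e ^ n)"
    by (simp add: power_minus[of "_ / _"] power_divide power_mult)
  also have "(e - 1) ^ (2 * n) =
      (\<Sum>k\<le>2 * n. of_nat (2 * n choose k) * (- 1) ^ k * e ^ (2 * n - k))"
    using binomial_ring[of "- 1" e "2 * n"] by simp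
  also have "(- 1) ^ n * (\<dots> / e ^ n) =
      (\<Sum>k\<le>2 * n. of_real ((- 1) ^ (n + k) * real (2 * n choose k)) * (e ^ (2 * n - k) / e ^ n))"
    by (simp add: sum_distrib_left sum_divide_distrib power_add mult_ac)
  also have "\<dots> = (\<Sum>k\<le>2 * n. of_real ((- 1) ^ (n + k) * real (2 * n choose k)) *
      exp (\<i> * of_real ((real n - real k) * y)))"
  proof (intro sum.cong refl arg_cong2[where f = "(*)"])
    fix k assume "k \<in> {..2 * n}"
    then show "e ^ (2 * n - k) / e ^ n = exp (\<i> * of_real ((real n - real k) * y))"
      by (simp add: e_def of_nat_diff algebra_simps flip: exp_of_nat_mult exp_diff)
  qed
  finally show ?thesis .
qed

lemma (in prob_space) even_moment_le:
  fixes X :: "'a \<Rightarrow> real" and a :: "nat \<Rightarrow> real"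
  assumes X [measurable]: "X \<in> borel_measurable M"
    and summ: "\<And>x. summable (\<lambda>m. a m * x ^ m)"
    and char: "\<And>t. (\<integral>\<omega>. exp (\<i> * of_real (t * X \<omega>)) \<partial>M) = of_real (\<Sum>m. a m * (- (t\<^sup>2)) ^ m)"
  shows "(\<integral>\<^sup>+ \<omega>. ennreal (X \<omega> ^ (2 * n)) \<partial>M) \<le> ennreal (fact (2 * n) * a n)"
proof -
  define b where "b k = (- 1) ^ (n + k) * real (2 * n choose k)" for k
  \<comment> \<open>These turn out to be the coefficients of E[(2 - 2 cos(tX))^n] as a power series
    in t^2.\<close>
  define c where "c m = (- 1) ^ m * a m * (\<Sum>k\<le>2 * n. b k * (real n - real k) ^ (2 * m))" for m
  have c_sums: "(\<lambda>m. c m * (t\<^sup>2) ^ m) sums (\<integral>\<omega>. (2 - 2 * cos (t * X \<omega>)) ^ n \<partial>M)" for t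
  proof -
    have int: "integrable M (\<lambda>\<omega>. exp (\<i> * of_real (s * X \<omega>)))" for s
      by (rule integrable_const_bound[where B = 1]) auto
    have "complex_of_real (\<integral>\<omega>. (2 - 2 * cos (t * X \<omega>)) ^ n \<partial>M) =
        (\<integral>\<omega>. (\<Sum>k\<le>2 * n. of_real (b k) * exp (\<i> * of_real (((real n - real k) * t) * X \<omega>))) \<partial>M)"
      unfolding b_def mult.assoc
      by (subst integral_complex_of_real[symmetric], subst two_minus_two_cos_power) (rule refl)
    also have "\<dots> = (\<Sum>k\<le>2 * n. of_real (b k) *
        (\<integral>\<omega>. exp (\<i> * of_real (((real n - real k) * t) * X \<omega>)) \<partial>M))"
      by (subst Bochner_Integration.integral_sum[OF integrable_mult_right[OF int]]) simp
    also have "\<dots> = of_real (\<Sum>k\<le>2 * n. b k * (\<Sum>m. a m * (- (((real n - real k) * t)\<^sup>2)) ^ m))"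
      unfolding char by simp
    finally have "(\<integral>\<omega>. (2 - 2 * cos (t * X \<omega>)) ^ n \<partial>M) =
        (\<Sum>k\<le>2 * n. b k * (\<Sum>m. a m * (- (((real n - real k) * t)\<^sup>2)) ^ m))"
      using of_real_eq_iff by blast
    moreover have "(\<lambda>m. \<Sum>k\<le>2 * n. b k * (a m * (- (((real n - real k) * t)\<^sup>2)) ^ m)) sums
        (\<Sum>k\<le>2 * n. b k * (\<Sum>m. a m * (- (((real n - real k) * t)\<^sup>2)) ^ m))"
      by (intro sums_sum sums_mult summable_sums summ)
    moreover have "(\<Sum>k\<le>2 * n. b k * (a m * (- (((real n - real k) * t)\<^sup>2)) ^ m)) = c m * (t\<^sup>2) ^ m" for m
      unfolding c_def sum_distrib_left sum_distrib_right
    proof (rule sum.cong[OF refl])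
      fix k
      have "(- (((real n - real k) * t)\<^sup>2)) ^ m = (- 1) ^ m * (real n - real k) ^ (2 * m) * (t\<^sup>2) ^ m"
        by (subst power_minus) (simp add: power_mult_distrib power_mult)
      then show "b k * (a m * (- (((real n - real k) * t)\<^sup>2)) ^ m) =
          (- 1) ^ m * a m * (b k * (real n - real k) ^ (2 * m)) * (t\<^sup>2) ^ m"
        by simp
    qed
    ultimately show ?thesis by simp
  qed
  \<comment> \<open>The series starts at index n. There the sign (-1)^n inside \<open>b\<close>
    cancels the one coming from (-(t^2))^n.\<close>
  have c_low: "c m = (if m = n then fact (2 * n) * a n else 0)" if "m \<le> n" for m
  proof -
    have "(\<Sum>k\<le>2 * n. b k * (real n - real k) ^ (2 * m)) =
        (- 1) ^ n * (\<Sum>k\<le>2 * n. real (2 * n choose k) * (- 1) ^ k * (real n - real k) ^ (2 * m))"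
      by (simp add: b_def sum_distrib_left power_add mult_ac)
    then show ?thesis
      unfolding c_def central_difference_even_power[OF that] by (auto simp flip: power_add)
  qed
  \<comment> \<open>Fatou's lemma is applied along a sequence, so t -> 0 is discretised; the terms
    are nonzero because t^2 is a divisor.\<close>
  define t where "t j = 1 / real (Suc j)" for j
  have t0: "t \<longlonglongrightarrow> 0" and t_nz: "t j \<noteq> 0" for j
    unfolding t_def by (rule LIMSEQ_Suc[OF lim_1_over_n]) simp
  have lim: "(\<lambda>j. \<integral>\<omega>. ((2 - 2 * cos (t j * X \<omega>)) / (t j)\<^sup>2) ^ n \<partial>M) \<longlonglongrightarrow> fact (2 * n) * a n"
  proof -
    \<comment> \<open>Division by t^(2n) shifts the series by n. The limit at 0 is then its constant
      term \<open>c n\<close>.\<close>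
    define f where "f x = (\<Sum>m. c (m + n) * x ^ m)" for x
    have c_all: "summable (\<lambda>m. c (m + n) * x ^ m)" if "norm x < 1" for x
    proof -
      \<comment> \<open>Convergence at the single point 1, the case t = 1, already gives convergence
        for |x| < 1, enough for a limit at 0.\<close>
      have "summable (\<lambda>m. c m * 1 ^ m)"
        using c_sums[of 1] by (auto simp: sums_iff)
      then have "summable (\<lambda>m. c (m + n) * 1 ^ m)"
        using summable_iff_shift[of c n] by simp
      from powser_inside[OF this] show ?thesis using that by simp
    qed
    have "(f \<longlongrightarrow> c (0 + n)) (at 0)"
      unfolding f_def
      by (rule powser_limit_0[where s = 1 and a = "\<lambda>m. c (m + n)"]) (auto intro!: summable_sums c_all)
    moreover have "filterlim (\<lambda>j. (t j)\<^sup>2) (at 0) sequentially"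
      using tendsto_power[OF t0, of 2] t_nz by (auto simp: filterlim_at)
    ultimately have "(\<lambda>j. f ((t j)\<^sup>2)) \<longlonglongrightarrow> fact (2 * n) * a n"
      using c_low[of n] by (auto intro: filterlim_compose)
    moreover have "f ((t j)\<^sup>2) = (\<integral>\<omega>. ((2 - 2 * cos (t j * X \<omega>)) / (t j)\<^sup>2) ^ n \<partial>M)" for j
    proof -
      let ?I = "\<integral>\<omega>. (2 - 2 * cos (t j * X \<omega>)) ^ n \<partial>M"
      have "(\<lambda>m. c (m + n) * ((t j)\<^sup>2) ^ (m + n)) sums ?I"
        using c_low sums_iff_shift[of "\<lambda>m. c m * ((t j)\<^sup>2) ^ m" n] c_sums[of "t j"] by simp
      then have "(\<lambda>m. c (m + n) * ((t j)\<^sup>2) ^ (m + n) / ((t j)\<^sup>2) ^ n) sums (?I / ((t j)\<^sup>2) ^ n)"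
        by (rule sums_divide)
      then show ?thesis
        using t_nz[of j] by (simp add: f_def power_add sums_iff power_divide)
    qed
    ultimately show ?thesis by simp
  qed
  have nn: "0 \<le> (2 - 2 * cos y) / x\<^sup>2" for x y :: real by simp
  have ptw: "(\<lambda>j. ((2 - 2 * cos (t j * x)) / (t j)\<^sup>2) ^ n) \<longlonglongrightarrow> x ^ (2 * n)" for x
  proof -
    have "((\<lambda>s. (2 - 2 * cos (s * x)) / s\<^sup>2) \<longlongrightarrow> x\<^sup>2) (at 0)"
      by (real_asymp simp: power2_eq_square)
    moreover have "filterlim t (at 0) sequentially"
      using t0 t_nz by (auto simp: filterlim_at)
    ultimately have "(\<lambda>j. (2 - 2 * cos (t j * x)) / (t j)\<^sup>2) \<longlonglongrightarrow> x\<^sup>2"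
      by (rule filterlim_compose)
    from tendsto_power[OF this, of n] show ?thesis by (simp add: power_mult)
  qed
  have bound: "norm (2 - 2 * cos y) \<le> 4" for y :: real
    using cos_ge_minus_one[of y] cos_le_one[of y] unfolding real_norm_def abs_le_iff by linarith
  \<comment> \<open>Fatou concerns nonnegative integrals, \<open>lim\<close> Bochner integrals. They
    agree because, for fixed j, the integrand is nonnegative and bounded.\<close>
  have eq: "(\<integral>\<^sup>+ \<omega>. ennreal (((2 - 2 * cos (t j * X \<omega>)) / (t j)\<^sup>2) ^ n) \<partial>M) =
      ennreal (\<integral>\<omega>. ((2 - 2 * cos (t j * X \<omega>)) / (t j)\<^sup>2) ^ n \<partial>M)" for j
  proof (rule nn_integral_eq_integral)
    have "norm (((2 - 2 * cos y) / (t j)\<^sup>2) ^ n) \<le> (4 / (t j)\<^sup>2) ^ n" for y :: real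
      unfolding norm_power[of _ n] norm_divide
      by (intro power_mono frac_le bound) (use t_nz[of j] in auto)
    then show "integrable M (\<lambda>\<omega>. ((2 - 2 * cos (t j * X \<omega>)) / (t j)\<^sup>2) ^ n)"
      by (intro integrable_const_bound[where B = "(4 / (t j)\<^sup>2) ^ n"] AE_I2) measurable
  qed (use nn in simp)
  have "(\<integral>\<^sup>+ \<omega>. ennreal (X \<omega> ^ (2 * n)) \<partial>M) =
      (\<integral>\<^sup>+ \<omega>. liminf (\<lambda>j. ennreal (((2 - 2 * cos (t j * X \<omega>)) / (t j)\<^sup>2) ^ n)) \<partial>M)"
    by (intro nn_integral_cong lim_imp_Liminf[OF sequentially_bot, symmetric] tendsto_ennrealI[OF ptw])
  also have "\<dots> \<le> liminf (\<lambda>j. \<integral>\<^sup>+ \<omega>. ennreal (((2 - 2 * cos (t j * X \<omega>)) / (t j)\<^sup>2) ^ n) \<partial>M)"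
    by (rule nn_integral_liminf) measurable
  also have "\<dots> = ennreal (fact (2 * n) * a n)"
    unfolding eq by (rule lim_imp_Liminf[OF sequentially_bot tendsto_ennrealI[OF lim]])
  finally show ?thesis .
qed

text \<open>The (2n)! in the moment bound cancels the one in the cosh series, leaving the sum of the
  \<open>a n\<close>. Only even moments are controlled, so exp x <= 2 cosh x is used, whence the
  factor 2.\<close>

lemma (in prob_space) exp_moment_of_entire_char:
  fixes X :: "'a \<Rightarrow> real" and a :: "nat \<Rightarrow> real"
  assumes X [measurable]: "X \<in> borel_measurable M"
    and summ: "\<And>x. summable (\<lambda>m. a m * x ^ m)"
    and nonneg: "\<And>m. 0 \<le> a m"
    and char: "\<And>t. (\<integral>\<omega>. exp (\<i> * of_real (t * X \<omega>)) \<partial>M) = of_real (\<Sum>m. a m * (- (t\<^sup>2)) ^ m)"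
  shows "integrable M (\<lambda>\<omega>. exp (X \<omega>))" and "(\<integral>\<omega>. exp (X \<omega>) \<partial>M) \<le> 2 * (\<Sum>m. a m)"
proof -
  have summ1: "summable a"
    using summ[of 1] by simp
  have "(\<integral>\<^sup>+ \<omega>. ennreal (cosh (X \<omega>)) \<partial>M) =
      (\<integral>\<^sup>+ \<omega>. (\<Sum>n. ennreal (X \<omega> ^ (2 * n) / fact (2 * n))) \<partial>M)"
  proof (rule nn_integral_cong)
    fix \<omega>
    \<comment> \<open>\<open>cosh_converges\<close> runs over all indices with zeros at the odd
      ones; reindexing by n -> 2n removes them.\<close>
    have "(\<lambda>n. X \<omega> ^ (2 * n) / fact (2 * n)) sums cosh (X \<omega>)"
      using cosh_converges[of "X \<omega>"]
        sums_mono_reindex[of "\<lambda>n. 2 * n" "\<lambda>n. if even n then X \<omega> ^ n /\<^sub>R fact n else 0" "cosh (X \<omega>)"]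
      by (force simp: strict_mono_def divide_inverse_commute)
    then show "ennreal (cosh (X \<omega>)) = (\<Sum>n. ennreal (X \<omega> ^ (2 * n) / fact (2 * n)))"
      by (subst suminf_ennreal2) (auto simp: sums_iff zero_le_even_power)
  qed
  also have "\<dots> = (\<Sum>n. \<integral>\<^sup>+ \<omega>. ennreal (X \<omega> ^ (2 * n) / fact (2 * n)) \<partial>M)"
    by (rule nn_integral_suminf) measurable
  also have "\<dots> \<le> (\<Sum>n. ennreal (a n))"
  proof (intro suminf_le summableI)
    fix n
    have "(\<integral>\<^sup>+ \<omega>. ennreal (X \<omega> ^ (2 * n) / fact (2 * n)) \<partial>M) =
        ennreal (1 / fact (2 * n)) * (\<integral>\<^sup>+ \<omega>. ennreal (X \<omega> ^ (2 * n)) \<partial>M)"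
      by (subst nn_integral_cmult[symmetric])
        (auto simp: ennreal_mult'[symmetric] zero_le_even_power intro!: nn_integral_cong)
    also have "\<dots> \<le> ennreal (1 / fact (2 * n)) * ennreal (fact (2 * n) * a n)"
      by (intro mult_left_mono even_moment_le[OF X summ char]) simp
    also have "\<dots> = ennreal (a n)"
      by (subst ennreal_mult'[symmetric]) auto
    finally show "(\<integral>\<^sup>+ \<omega>. ennreal (X \<omega> ^ (2 * n) / fact (2 * n)) \<partial>M) \<le> ennreal (a n)" .
  qed
  also have "\<dots> = ennreal (\<Sum>m. a m)"
    by (rule suminf_ennreal2[OF nonneg summ1])
  finally have cosh: "(\<integral>\<^sup>+ \<omega>. ennreal (cosh (X \<omega>)) \<partial>M) \<le> ennreal (\<Sum>m. a m)" .
  have "(\<integral>\<^sup>+ \<omega>. ennreal (exp (X \<omega>)) \<partial>M) \<le> (\<integral>\<^sup>+ \<omega>. ennreal 2 * ennreal (cosh (X \<omega>)) \<partial>M)"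
    by (intro nn_integral_mono) (simp add: cosh_field_def del: ennreal_numeral flip: ennreal_mult')
  also have "\<dots> \<le> ennreal 2 * ennreal (\<Sum>m. a m)"
    using cosh by (subst nn_integral_cmult) (auto simp: cosh_field_def intro: mult_left_mono)
  also have "\<dots> = ennreal (2 * (\<Sum>m. a m))"
    by (simp add: ennreal_mult')
  finally have *: "(\<integral>\<^sup>+ \<omega>. ennreal (exp (X \<omega>)) \<partial>M) \<le> ennreal (2 * (\<Sum>m. a m))" .
  then show "integrable M (\<lambda>\<omega>. exp (X \<omega>))"
    by (intro integrableI_bounded) (auto intro: le_less_trans)
  show "(\<integral>\<omega>. exp (X \<omega>) \<partial>M) \<le> 2 * (\<Sum>m. a m)"
    using * suminf_nonneg[OF summ1 nonneg]
    by (subst integral_eq_nn_integral) (auto intro: enn2real_leI)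
qed

section \<open>Holomorphy of exponential integrals in one complex variable\<close>

text \<open>For |w| < r the partial sums of the norms of the terms of exp(A) exp(wB) stay below
  exp(Re A + r|B|). Hence sum and integral commute and the result is a power series in w.\<close>

lemma laplace_integral_holomorphic:
  fixes A B :: "'a \<Rightarrow> complex"
  assumes A [measurable]: "A \<in> borel_measurable M" and B [measurable]: "B \<in> borel_measurable M"
    and int: "integrable M (\<lambda>x. exp (Re (A x) + r * norm (B x)))"
  shows "(\<lambda>z. \<integral>x. exp (A x + z * B x) \<partial>M) holomorphic_on ball 0 r"
proof (rule power_series_holomorphic)
  fix w :: complex assume "w \<in> ball 0 r"
  then have w: "norm w \<le> r" by simp
  define f where "f n x = exp (A x) * ((w * B x) ^ n /\<^sub>R fact n)" for n x
  have norm_f: "norm (f n x) = exp (Re (A x)) * ((norm (w * B x)) ^ n /\<^sub>R fact n)" for n x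
    by (simp add: f_def norm_mult norm_power)
  have dom: "(\<Sum>i<n. norm (f i x)) \<le> exp (Re (A x) + r * norm (B x))" for n x
  proof -
    have "(\<Sum>i<n. (norm (w * B x)) ^ i /\<^sub>R fact i) \<le> exp (norm (w * B x))"
      unfolding exp_def by (intro sum_le_suminf summable_exp_generic) auto
    also have "\<dots> \<le> exp (r * norm (B x))"
      using w by (simp add: norm_mult mult_right_mono)
    finally show ?thesis
      by (simp add: norm_f exp_add flip: sum_distrib_left)
  qed
  have [measurable]: "f n \<in> borel_measurable M" for n
    unfolding f_def by measurable
  have int_f: "integrable M (f n)" for n
  proof (rule Bochner_Integration.integrable_bound[OF int])
    have "norm (f n x) \<le> exp (Re (A x) + r * norm (B x))" for x
      using dom[where n = "Suc n" and x = x] sum_nonneg[of "{..<n}" "\<lambda>i. norm (f i x)"] by simp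
    then show "AE x in M. norm (f n x) \<le> norm (exp (Re (A x) + r * norm (B x)))"
      by (intro AE_I2) simp
  qed measurable
  have "(\<lambda>n. integral\<^sup>L M (f n)) sums (\<integral>x. (\<Sum>n. f n x) \<partial>M)"
  proof (rule sums_integral[OF int_f])
    show "AE x in M. summable (\<lambda>n. norm (f n x))"
      by (intro AE_I2 summableI_nonneg_bounded[OF _ dom]) simp
    show "summable (\<lambda>n. \<integral>x. norm (f n x) \<partial>M)"
    proof (rule summableI_nonneg_bounded)
      fix n
      have "(\<Sum>i<n. \<integral>x. norm (f i x) \<partial>M) = (\<integral>x. (\<Sum>i<n. norm (f i x)) \<partial>M)"
        using int_f by simp
      also have "\<dots> \<le> (\<integral>x. exp (Re (A x) + r * norm (B x)) \<partial>M)"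
        using int_f by (intro integral_mono int dom) auto
      finally show "(\<Sum>i<n. \<integral>x. norm (f i x) \<partial>M) \<le> (\<integral>x. exp (Re (A x) + r * norm (B x)) \<partial>M)" .
    qed simp
  qed
  moreover have "(\<Sum>n. f n x) = exp (A x + w * B x)" for x
    using sums_mult[OF exp_converges[of "w * B x"], of "exp (A x)"]
    by (simp add: f_def exp_add sums_iff)
  \<comment> \<open>Pulling out w^n exposes the power series coefficients; \<open>w - 0\<close>
    records that the expansion is centred at 0.\<close>
  moreover have "integral\<^sup>L M (f n) = (\<integral>x. exp (A x) * (B x ^ n /\<^sub>R fact n) \<partial>M) * (w - 0) ^ n" for n
    by (subst integral_mult_left_zero[symmetric])
      (simp add: f_def[abs_def] power_mult_distrib mult_ac)
  ultimately show "(\<lambda>n. (\<integral>x. exp (A x) * (B x ^ n /\<^sub>R fact n) \<partial>M) * (w - 0) ^ n) sums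
      (\<integral>x. exp (A x + w * B x) \<partial>M)"
    by simp
qed

section \<open>Schwartz seminorms and the quadratic form\<close>

lemma schwartz_fun_smooth: "smooth_real (schwartz_fun f)"
  and schwartz_fun_rapidly_decreasing: "rapidly_decreasing (schwartz_fun f)"
  using schwartz_fun[of f] by auto

text \<open>Rapid decrease makes the family bounded above, so the supremum in the seminorm is a
  genuine one.\<close>

lemma abs_le_schwartz_seminorm:
  "\<bar>x ^ m * (deriv ^^ k) (schwartz_fun f) x\<bar> \<le> schwartz_seminorm m k f"
  unfolding schwartz_seminorm_def
proof (rule cSUP_upper)
  have "bounded (range (\<lambda>x. x ^ m * (deriv ^^ k) (schwartz_fun f) x))"
    using schwartz_fun_rapidly_decreasing[of f] by (simp add: rapidly_decreasing_def)
  then show "bdd_above (range (\<lambda>x. \<bar>x ^ m * (deriv ^^ k) (schwartz_fun f) x\<bar>))"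
    by (auto simp: bounded_iff bdd_above_def)
qed simp

lemma schwartz_seminorm_add:
  "schwartz_seminorm m k (f + g) \<le> schwartz_seminorm m k f + schwartz_seminorm m k g"
proof -
  have "\<bar>x ^ m * (deriv ^^ k) (schwartz_fun (f + g)) x\<bar>
      \<le> schwartz_seminorm m k f + schwartz_seminorm m k g" for x
  proof -
    have "x ^ m * (deriv ^^ k) (schwartz_fun (f + g)) x =
        x ^ m * (deriv ^^ k) (schwartz_fun f) x + x ^ m * (deriv ^^ k) (schwartz_fun g) x"
      by (simp add: plus_schwartz.rep_eq smooth_real_deriv_add schwartz_fun_smooth distrib_left)
    then show ?thesis
      using abs_le_schwartz_seminorm[of x m k f] abs_le_schwartz_seminorm[of x m k g] by linarith
  qed
  then show ?thesis
    unfolding schwartz_seminorm_def[of m k "f + g"] by (intro cSUP_least) auto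
qed

lemma schwartz_seminorm_zero [simp]: "schwartz_seminorm m k 0 = 0"
  by (simp add: schwartz_seminorm_def zero_schwartz.rep_eq deriv_iterate_zero)

lemma open_schwartz_seminorm_ball: "open {g. schwartz_seminorm m k (g - f) < e}"
  unfolding open_schwartz_def
proof
  fix g assume g: "g \<in> {g. schwartz_seminorm m k (g - f) < e}"
  show "\<exists>N. \<exists>\<epsilon>>0. \<forall>h. (\<forall>m\<le>N. \<forall>k\<le>N. schwartz_seminorm m k (h - g) < \<epsilon>) \<longrightarrow>
      h \<in> {g. schwartz_seminorm m k (g - f) < e}"
  \<comment> \<open>The order \<open>max m k\<close> makes the basic neighbourhood control this
    seminorm, and the radius is what the triangle inequality leaves.\<close>
  proof (intro exI[of _ "max m k"] exI[of _ "e - schwartz_seminorm m k (g - f)"] conjI allI impI)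
    fix h assume "\<forall>m'\<le>max m k. \<forall>k'\<le>max m k.
      schwartz_seminorm m' k' (h - g) < e - schwartz_seminorm m k (g - f)"
    then have "schwartz_seminorm m k (h - g) < e - schwartz_seminorm m k (g - f)" by simp
    then show "h \<in> {g. schwartz_seminorm m k (g - f) < e}"
      using schwartz_seminorm_add[of m k "h - g" "g - f"] by simp
  qed (use g in simp)
qed

text \<open>The form <\<phi>, \<phi>> on which the characteristic function of the measure
  depends.\<close>

definition schwartz_energy :: "schwartz \<Rightarrow> real" where
  "schwartz_energy f = (\<integral>x. (schwartz_fun f x)\<^sup>2 \<partial>lborel)"

lemma schwartz_energy_nonneg: "0 \<le> schwartz_energy f"
  by (simp add: schwartz_energy_def)

lemma schwartz_energy_scaleR: "schwartz_energy (t *\<^sub>R f) = t\<^sup>2 * schwartz_energy f"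
  by (simp add: schwartz_energy_def scaleR_schwartz.rep_eq power_mult_distrib)

text \<open>The two seminorms bound f(x)^2 (1 + x^2) uniformly, and 1/(1 + x^2) has integral
  pi.\<close>

lemma schwartz_energy_le:
  "schwartz_energy f \<le> pi * ((schwartz_seminorm 0 0 f)\<^sup>2 + (schwartz_seminorm 1 0 f)\<^sup>2)"
proof -
  let ?C = "(schwartz_seminorm 0 0 f)\<^sup>2 + (schwartz_seminorm 1 0 f)\<^sup>2"
  have int: "integrable lborel (\<lambda>x::real. inverse (1 + x\<^sup>2))"
    using integrable_inverse_1_plus_square by (simp add: set_integrable_def)
  have pi: "(\<integral>x. inverse (1 + x\<^sup>2) \<partial>lborel) = pi"
    using LBINT_inverse_1_plus_square
    by (simp add: interval_lebesgue_integral_def set_lebesgue_integral_def)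
  have "schwartz_energy f \<le> (\<integral>x. ?C * inverse (1 + x\<^sup>2) \<partial>lborel)"
    unfolding schwartz_energy_def
  proof (rule integral_mono')
    fix x :: real
    have "(schwartz_fun f x)\<^sup>2 \<le> (schwartz_seminorm 0 0 f)\<^sup>2"
      using abs_le_schwartz_seminorm[of x 0 0 f] by (intro abs_le_square_iff[THEN iffD1]) simp
    moreover have "(x * schwartz_fun f x)\<^sup>2 \<le> (schwartz_seminorm 1 0 f)\<^sup>2"
      using abs_le_schwartz_seminorm[of x 1 0 f] by (intro abs_le_square_iff[THEN iffD1]) simp
    ultimately have "(schwartz_fun f x)\<^sup>2 * (1 + x\<^sup>2) \<le> ?C"
      by (simp add: algebra_simps power_mult_distrib)
    then show "(schwartz_fun f x)\<^sup>2 \<le> ?C * inverse (1 + x\<^sup>2)"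
      by (subst divide_inverse[symmetric], subst pos_le_divide_eq) (auto simp: add_pos_nonneg)
  qed (use int in simp_all)
  then show ?thesis
    by (simp add: pi mult.commute)
qed

text \<open>On the unit neighbourhood of f for the two seminorms of the preceding bound, each
  seminorm exceeds its value at f by at most 1.\<close>

lemma schwartz_energy_locally_bounded:
  obtains U B where "open U" "f \<in> U" "\<And>g. g \<in> U \<Longrightarrow> schwartz_energy g \<le> B"
proof
  let ?U = "{g. schwartz_seminorm 0 0 (g - f) < 1} \<inter> {g. schwartz_seminorm 1 0 (g - f) < 1}"
  let ?p = "\<lambda>m. schwartz_seminorm m 0 f + 1"
  show "open ?U" by (intro open_Int open_schwartz_seminorm_ball)
  show "f \<in> ?U" by simp
  show "schwartz_energy g \<le> pi * ((?p 0)\<^sup>2 + (?p 1)\<^sup>2)" if "g \<in> ?U" for g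
  proof -
    have nonneg: "0 \<le> schwartz_seminorm m 0 g" for m
      using abs_le_schwartz_seminorm[of 0 m 0 g] by linarith
    have "schwartz_seminorm 0 0 g \<le> ?p 0" "schwartz_seminorm 1 0 g \<le> ?p 1"
      using that schwartz_seminorm_add[of 0 0 "g - f" f] schwartz_seminorm_add[of 1 0 "g - f" f]
      by auto
    then have "pi * ((schwartz_seminorm 0 0 g)\<^sup>2 + (schwartz_seminorm 1 0 g)\<^sup>2)
        \<le> pi * ((?p 0)\<^sup>2 + (?p 1)\<^sup>2)"
      by (intro mult_left_mono add_mono power_mono nonneg) auto
    with schwartz_energy_le[of g] show ?thesis by linarith
  qed
qed

section \<open>Exponential moments of the Mittag-Leffler measure\<close>

lemma space_cylinder_algebra: "space cylinder_algebra = tempered_distributions"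
  unfolding cylinder_algebra_def by (rule space_measure_of) auto

lemma measurable_evaluation [measurable]:
  "(\<lambda>\<omega>. \<omega> \<phi>) \<in> borel_measurable cylinder_algebra"
proof (rule measurableI)
  fix B :: "real set" assume "B \<in> sets borel"
  then show "(\<lambda>\<omega>. \<omega> \<phi>) -` B \<inter> space cylinder_algebra \<in> sets cylinder_algebra"
    unfolding space_cylinder_algebra unfolding cylinder_algebra_def
    by (subst sets_measure_of) (auto intro!: sigma_sets.Basic exI[of _ \<phi>] exI[of _ B])
qed simp

lemma mittag_leffler_of_real:
  assumes "0 < \<beta>"
  shows "mittag_leffler \<beta> (of_real x) = of_real (\<Sum>n. x ^ n / Gamma (\<beta> * real n + 1))"
proof -
  have "complex_of_real x ^ n / Gamma (complex_of_real (\<beta> * real n + 1)) =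
      of_real (x ^ n / Gamma (\<beta> * real n + 1))" for n
    by (simp only: Gamma_complex_of_real of_real_divide of_real_power)
  then show ?thesis
    unfolding mittag_leffler_def by (simp only: suminf_of_real[OF summable_power_over_Gamma[OF assms]])
qed

text \<open>The general moment bound is applied to evaluation at \<phi>. The resulting sum is
  E_\<beta>(<\<phi>, \<phi>>/2), the characteristic series with its alternating signs
  removed.\<close>

lemma mittag_leffler_measure_exp:
  assumes \<beta>: "0 < \<beta>" and \<mu>: "mittag_leffler_measure \<beta> \<mu>"
  shows "integrable \<mu> (\<lambda>\<omega>. exp (\<omega> \<phi>))"
    and "(\<integral>\<omega>. exp (\<omega> \<phi>) \<partial>\<mu>) \<le> 2 * (\<Sum>n. (schwartz_energy \<phi> / 2) ^ n / Gamma (\<beta> * real n + 1))"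
proof -
  interpret prob_space \<mu> using \<mu> by (simp add: mittag_leffler_measure_def)
  have [measurable_cong]: "sets \<mu> = sets cylinder_algebra"
    using \<mu> by (simp add: mittag_leffler_measure_def)
  then have sp: "space \<mu> = tempered_distributions"
    using sets_eq_imp_space_eq space_cylinder_algebra by metis
  define a where "a n = (schwartz_energy \<phi> / 2) ^ n / Gamma (\<beta> * real n + 1)" for n
  have pow: "(schwartz_energy \<phi> / 2 * x) ^ n / Gamma (\<beta> * real n + 1) = a n * x ^ n" for n x
    by (simp add: a_def power_mult_distrib power_divide)
  have summ: "summable (\<lambda>n. a n * x ^ n)" for x
    using summable_power_over_Gamma[OF \<beta>, of "schwartz_energy \<phi> / 2 * x"] unfolding pow .
  have nonneg: "0 \<le> a n" for n
    unfolding a_def using \<beta> Gamma_real_pos[of "\<beta> * real n + 1"]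
    by (intro divide_nonneg_nonneg zero_le_power)
      (auto simp: schwartz_energy_nonneg add_nonneg_pos less_imp_le)
  have char: "(\<integral>\<omega>. exp (\<i> * of_real (t * \<omega> \<phi>)) \<partial>\<mu>) = of_real (\<Sum>n. a n * (- (t\<^sup>2)) ^ n)" for t
  proof -
    \<comment> \<open>Linearity of \<omega> on the space of \<mu> moves t into the test function,
      where the defining property of \<mu> applies; the form then scales by t^2.\<close>
    have "(\<integral>\<omega>. exp (\<i> * of_real (t * \<omega> \<phi>)) \<partial>\<mu>) = (\<integral>\<omega>. exp (\<i> * of_real (\<omega> (t *\<^sub>R \<phi>))) \<partial>\<mu>)"
      by (rule Bochner_Integration.integral_cong)
        (auto simp: sp tempered_distributions_def linear_scale)
    also have "\<dots> = mittag_leffler \<beta> (of_real (- (1/2) * schwartz_energy (t *\<^sub>R \<phi>)))"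
      using \<mu> unfolding mittag_leffler_measure_def schwartz_energy_def by blast
    also have "- (1/2) * schwartz_energy (t *\<^sub>R \<phi>) = schwartz_energy \<phi> / 2 * - (t\<^sup>2)"
      by (simp add: schwartz_energy_scaleR)
    finally show ?thesis
      unfolding mittag_leffler_of_real[OF \<beta>] pow .
  qed
  show "integrable \<mu> (\<lambda>\<omega>. exp (\<omega> \<phi>))"
    by (rule exp_moment_of_entire_char(1)[OF _ summ nonneg char]) measurable
  have "(\<integral>\<omega>. exp (\<omega> \<phi>) \<partial>\<mu>) \<le> 2 * (\<Sum>n. a n)"
    by (rule exp_moment_of_entire_char(2)[OF _ summ nonneg char]) measurable
  then show "(\<integral>\<omega>. exp (\<omega> \<phi>) \<partial>\<mu>) \<le>
      2 * (\<Sum>n. (schwartz_energy \<phi> / 2) ^ n / Gamma (\<beta> * real n + 1))"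
    by (simp add: a_def)
qed

section \<open>Pairings under the product measure\<close>

text \<open>The exponential of the pairing is a product of functions of separate coordinates, so
  everything reduces to one factor.\<close>

lemma
  fixes \<psi> :: "schwartz ^ 'd::finite"
  assumes \<mu>: "prob_space \<mu>" and int: "\<And>\<phi>. integrable \<mu> (\<lambda>\<omega>. exp (\<omega> \<phi> :: real))"
  shows integrable_exp_pairing: "integrable (product_measure \<mu>) (\<lambda>\<omega>. exp (pairing \<omega> \<psi>))"
    and integral_exp_pairing: "(\<integral>\<omega>. exp (pairing \<omega> \<psi>) \<partial>product_measure \<mu>) =
      (\<Prod>i\<in>UNIV. \<integral>\<omega>. exp (\<omega> (\<psi> $ i)) \<partial>\<mu>)"
proof -
  interpret prob_space \<mu> by fact
  interpret product_sigma_finite "\<lambda>_ :: 'd. \<mu>" by standard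
  have exp_eq: "exp (pairing \<omega> \<psi>) = (\<Prod>i\<in>UNIV. exp (\<omega> i (\<psi> $ i)))" for \<omega>
    unfolding pairing_def by (rule exp_sum) simp
  show "integrable (product_measure \<mu>) (\<lambda>\<omega>. exp (pairing \<omega> \<psi>))"
    unfolding exp_eq product_measure_def by (rule product_integrable_prod[OF finite int])
  show "(\<integral>\<omega>. exp (pairing \<omega> \<psi>) \<partial>product_measure \<mu>) = (\<Prod>i\<in>UNIV. \<integral>\<omega>. exp (\<omega> (\<psi> $ i)) \<partial>\<mu>)"
    unfolding exp_eq product_measure_def by (rule product_integral_prod[OF finite int])
qed

lemma measurable_pairing:
  assumes [measurable_cong]: "sets \<mu> = sets cylinder_algebra"
  shows "(\<lambda>\<omega>. pairing \<omega> \<psi>) \<in> borel_measurable (product_measure \<mu>)"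
  unfolding pairing_def product_measure_def by measurable

lemma measurable_cpairing:
  assumes "sets \<mu> = sets cylinder_algebra"
  shows "(\<lambda>\<omega>. cpairing \<omega> \<phi>) \<in> borel_measurable (product_measure \<mu>)"
proof -
  note measurable_pairing[OF assms, measurable]
  show ?thesis unfolding cpairing_def by measurable
qed

text \<open>The type of \<omega> also contains nonlinear families; linearity holds for points of the
  space, whose coordinates are tempered distributions.\<close>

lemma pairing_linear:
  assumes "sets \<mu> = sets cylinder_algebra" "\<omega> \<in> space (product_measure \<mu>)"
  shows "linear (pairing \<omega>)"
proof -
  have "linear (\<omega> i)" for i
    using assms sets_eq_imp_space_eq[OF assms(1)]
    by (auto simp: product_measure_def space_PiM space_cylinder_algebra tempered_distributions_def)
  then show ?thesis
    by (intro linearI)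
      (auto simp: pairing_def linear_add linear_scale sum.distrib sum_distrib_left)
qed

text \<open>Puts the exponent on a complex line into the affine form A + zB of the one-variable
  result.\<close>

lemma cpairing_line:
  assumes "linear (pairing \<omega>)"
  shows "cpairing \<omega> (\<phi>\<^sub>0 + cscale z \<phi>) = cpairing \<omega> \<phi>\<^sub>0 + z * cpairing \<omega> \<phi>"
  by (simp add: cpairing_def cscale_def linear_add[OF assms] linear_diff[OF assms]
      linear_scale[OF assms] complex_eq_iff algebra_simps)

lemma norm_exp_cpairing: "norm (exp (cpairing \<omega> \<phi>)) = exp (pairing \<omega> (fst \<phi>))"
  by (simp add: cpairing_def)

lemma exp_abs_le: "exp \<bar>x\<bar> \<le> exp x + exp (- x :: real)"
  by (cases "x \<ge> 0") auto

text \<open>Since |w| <= |Re w| + |Im w| and exp|x| <= exp x + exp(-x), four exponentials of real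
  pairings dominate the integrand.\<close>

lemma integrable_exp_norm_cpairing:
  fixes \<phi>\<^sub>0 \<phi> :: "(schwartz ^ 'd::finite) complexified"
  assumes \<mu>: "prob_space \<mu>" and sets: "sets \<mu> = sets cylinder_algebra"
    and int: "\<And>\<phi>. integrable \<mu> (\<lambda>\<omega>. exp (\<omega> \<phi> :: real))" and r: "0 \<le> r"
  shows "integrable (product_measure \<mu>)
    (\<lambda>\<omega>. exp (Re (cpairing \<omega> \<phi>\<^sub>0) + r * norm (cpairing \<omega> \<phi>)))"
proof (rule Bochner_Integration.integrable_bound)
  note measurable_cpairing[OF sets, measurable]
  \<comment> \<open>The parameters s and t are the signs +1 and -1 attached to the real and
    imaginary directions.\<close>
  let ?p = "\<lambda>s t. fst \<phi>\<^sub>0 + (s * r) *\<^sub>R fst \<phi> + (t * r) *\<^sub>R snd \<phi>"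
  let ?e = "\<lambda>s t \<omega>. exp (pairing \<omega> (?p s t))"
  show "integrable (product_measure \<mu>) (\<lambda>\<omega>. ?e 1 1 \<omega> + ?e 1 (-1) \<omega> + ?e (-1) 1 \<omega> + ?e (-1) (-1) \<omega>)"
    by (intro Bochner_Integration.integrable_add integrable_exp_pairing \<mu> int)
  show "(\<lambda>\<omega>. exp (Re (cpairing \<omega> \<phi>\<^sub>0) + r * norm (cpairing \<omega> \<phi>)))
      \<in> borel_measurable (product_measure \<mu>)"
    by measurable
  show "AE \<omega> in product_measure \<mu>. norm (exp (Re (cpairing \<omega> \<phi>\<^sub>0) + r * norm (cpairing \<omega> \<phi>)))
      \<le> norm (?e 1 1 \<omega> + ?e 1 (-1) \<omega> + ?e (-1) 1 \<omega> + ?e (-1) (-1) \<omega>)"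
  proof (rule AE_I2)
    fix \<omega> assume "\<omega> \<in> space (product_measure \<mu> :: ('d \<Rightarrow> schwartz \<Rightarrow> real) measure)"
    note lin = pairing_linear[OF sets this]
    define a x y where "a = pairing \<omega> (fst \<phi>\<^sub>0)" and "x = r * pairing \<omega> (fst \<phi>)"
      and "y = r * pairing \<omega> (snd \<phi>)"
    have e: "?e s t \<omega> = exp a * (exp (s * x) * exp (t * y))" for s t
      by (simp add: linear_add[OF lin] linear_scale[OF lin] a_def x_def y_def exp_add mult_ac)
    have "norm (cpairing \<omega> \<phi>) \<le> \<bar>pairing \<omega> (fst \<phi>)\<bar> + \<bar>pairing \<omega> (snd \<phi>)\<bar>"
      using cmod_le[of "cpairing \<omega> \<phi>"] by (simp add: cpairing_def)
    then have "r * norm (cpairing \<omega> \<phi>) \<le> \<bar>x\<bar> + \<bar>y\<bar>"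
      using r mult_left_mono by (fastforce simp: x_def y_def abs_mult distrib_left)
    then have "exp (Re (cpairing \<omega> \<phi>\<^sub>0) + r * norm (cpairing \<omega> \<phi>)) \<le> exp a * (exp \<bar>x\<bar> * exp \<bar>y\<bar>)"
      by (simp add: cpairing_def a_def flip: exp_add)
    also have "\<dots> \<le> exp a * ((exp x + exp (- x)) * (exp y + exp (- y)))"
      by (intro mult_left_mono mult_mono exp_abs_le) auto
    also have "\<dots> = ?e 1 1 \<omega> + ?e 1 (-1) \<omega> + ?e (-1) 1 \<omega> + ?e (-1) (-1) \<omega>"
      unfolding e by (simp add: algebra_simps)
    finally show "norm (exp (Re (cpairing \<omega> \<phi>\<^sub>0) + r * norm (cpairing \<omega> \<phi>)))
        \<le> norm (?e 1 1 \<omega> + ?e 1 (-1) \<omega> + ?e (-1) 1 \<omega> + ?e (-1) (-1) \<omega>)"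
      by simp
  qed
qed

section \<open>Local boundedness and G-holomorphy of the Laplace transform\<close>

text \<open>The integrability conjunct ensures that the Bochner integral is nowhere merely its
  default value 0.\<close>

theorem proposition3p4:
  fixes \<beta> :: real
    and \<mu> :: "(schwartz \<Rightarrow> real) measure"
    and \<mu>d :: "('d::finite \<Rightarrow> schwartz \<Rightarrow> real) measure"
  assumes "0 < \<beta>" and "\<beta> \<le> 1"
    and "mittag_leffler_measure \<beta> \<mu>"
    and "\<mu>d = product_measure \<mu>"
  shows "(\<forall>\<phi>. integrable \<mu>d (\<lambda>\<omega>. exp (cpairing \<omega> \<phi>))) \<and>
    holomorphic_lcs (laplace_transform \<mu>d)"
proof -
  note \<beta> = \<open>0 < \<beta>\<close>
  have prob: "prob_space \<mu>" and sets: "sets \<mu> = sets cylinder_algebra"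
    using assms(3) by (auto simp: mittag_leffler_measure_def)
  have int: "integrable \<mu> (\<lambda>\<omega>. exp (\<omega> \<phi>))" for \<phi>
    by (rule mittag_leffler_measure_exp(1)[OF \<beta> assms(3)])
  have intd: "integrable \<mu>d (\<lambda>\<omega>. exp (cpairing \<omega> \<phi>))" for \<phi>
    unfolding assms(4)
  proof (rule Bochner_Integration.integrable_bound[OF integrable_exp_pairing[OF prob int, of "fst \<phi>"]])
    note measurable_cpairing[OF sets, measurable]
    show "(\<lambda>\<omega>. exp (cpairing \<omega> \<phi>)) \<in> borel_measurable (product_measure \<mu>)"
      by measurable
  qed (simp add: cpairing_def)
  have "locally_bounded (laplace_transform \<mu>d)"
    unfolding locally_bounded_def
  proof
    fix x :: "(schwartz ^ 'd) complexified"
    have "\<exists>U B. open U \<and> fst x $ i \<in> U \<and> (\<forall>g\<in>U. schwartz_energy g \<le> B)" for i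
      using schwartz_energy_locally_bounded[of "fst x $ i"] by metis
    then obtain U B where U: "\<And>i. open (U i)" "\<And>i. fst x $ i \<in> U i"
        "\<And>i g. g \<in> U i \<Longrightarrow> schwartz_energy g \<le> B i"
      by metis
    \<comment> \<open>The modulus of the integrand depends only on the real part of the argument, so
      the imaginary part is left unrestricted.\<close>
    let ?V = "{v. \<forall>i. v $ i \<in> U i} \<times> UNIV"
    let ?E = "\<lambda>s. 2 * (\<Sum>n. (s / 2) ^ n / Gamma (\<beta> * real n + 1))"
    have "norm (laplace_transform \<mu>d \<phi>) \<le> (\<Prod>i\<in>UNIV. ?E (B i))" if "\<phi> \<in> ?V" for \<phi>
    proof -
      have "norm (laplace_transform \<mu>d \<phi>) \<le> (\<integral>\<omega>. exp (pairing \<omega> (fst \<phi>)) \<partial>\<mu>d)"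
        unfolding laplace_transform_def norm_exp_cpairing[symmetric] by (rule integral_norm_bound)
      also have "\<dots> = (\<Prod>i\<in>UNIV. \<integral>\<omega>. exp (\<omega> (fst \<phi> $ i)) \<partial>\<mu>)"
        unfolding assms(4) by (rule integral_exp_pairing[OF prob int])
      also have "\<dots> \<le> (\<Prod>i\<in>UNIV. ?E (B i))"
      proof (rule prod_mono, rule conjI)
        fix i
        have "(\<integral>\<omega>. exp (\<omega> (fst \<phi> $ i)) \<partial>\<mu>) \<le> ?E (schwartz_energy (fst \<phi> $ i))"
          by (rule mittag_leffler_measure_exp(2)[OF \<beta> assms(3)])
        \<comment> \<open>Twice the Mittag-Leffler series at s/2 increases for s >= 0, its
          coefficients being nonnegative.\<close>
        also have "\<dots> \<le> ?E (B i)"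
        proof (intro mult_left_mono suminf_le summable_power_over_Gamma[OF \<beta>] divide_right_mono power_mono)
          show "schwartz_energy (fst \<phi> $ i) \<le> B i"
            using that U(3)[of "fst \<phi> $ i" i] by auto
          show "0 \<le> Gamma (\<beta> * real n + 1)" for n
            using \<beta> Gamma_real_pos[of "\<beta> * real n + 1"] by (simp add: add_nonneg_pos less_imp_le)
        qed (simp_all add: schwartz_energy_nonneg)
        finally show "(\<integral>\<omega>. exp (\<omega> (fst \<phi> $ i)) \<partial>\<mu>) \<le> ?E (B i)" .
      qed simp
      finally show ?thesis .
    qed
    then have "bounded (laplace_transform \<mu>d ` ?V)"
      unfolding bounded_iff by blast
    moreover have "open ?V" "x \<in> ?V"
      using U(1,2) by (auto intro!: open_Times open_vector_box simp: mem_Times_iff)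
    ultimately show "\<exists>V. open V \<and> x \<in> V \<and> bounded (laplace_transform \<mu>d ` V)"
      by blast
  qed
  moreover have "G_holomorphic (laplace_transform \<mu>d)"
    unfolding G_holomorphic_def
  proof (intro allI)
    fix \<phi>\<^sub>0 \<phi> :: "(schwartz ^ 'd) complexified"
    \<comment> \<open>Exponential moments of every size exist, so any positive radius works; 1
      suffices for analyticity at 0.\<close>
    have "(\<lambda>z. \<integral>\<omega>. exp (cpairing \<omega> \<phi>\<^sub>0 + z * cpairing \<omega> \<phi>) \<partial>\<mu>d) holomorphic_on ball 0 1"
      unfolding assms(4)
      by (intro laplace_integral_holomorphic measurable_cpairing integrable_exp_norm_cpairing
          prob sets int) simp
    moreover have "laplace_transform \<mu>d (\<phi>\<^sub>0 + cscale z \<phi>) =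
        (\<integral>\<omega>. exp (cpairing \<omega> \<phi>\<^sub>0 + z * cpairing \<omega> \<phi>) \<partial>\<mu>d)" for z
      unfolding laplace_transform_def
    proof (rule Bochner_Integration.integral_cong[OF refl])
      fix \<omega> assume "\<omega> \<in> space \<mu>d"
      then show "exp (cpairing \<omega> (\<phi>\<^sub>0 + cscale z \<phi>)) = exp (cpairing \<omega> \<phi>\<^sub>0 + z * cpairing \<omega> \<phi>)"
        unfolding assms(4) by (simp only: cpairing_line[OF pairing_linear[OF sets]])
    qed
    ultimately show "(\<lambda>z. laplace_transform \<mu>d (\<phi>\<^sub>0 + cscale z \<phi>)) analytic_on {0}"
      unfolding analytic_on_def by (auto intro!: exI[of _ 1])
  qed
  ultimately show ?thesis
    using intd by (simp add: holomorphic_lcs_def)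
qed

end
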